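(* Let $p\in[1,\infty]$, $p^{-1}+q^{-1}=1$, $\gamma\ge0$, let $\Psi=\{\psi_{ij}: i\ne j,\ i,j\in I_N\}\subset\mathbb{R}^n$ be a $(\gamma,p)$-good set of probe vectors, let $\delta\in(0,1)$, and let $$\varkappa=\varkappa(\delta,\Psi):=\min\Big\{\varkappa>0:\mathbb{P}\Big(\max_{\psi\in\Psi}\frac{|Z(\psi)|}{|\psi|_\Sigma}\ge\varkappa\Big)\le\delta\Big\}.$$ Assume that $\max\{|\mu|_p,|\mu_1|_p,\dots,|\mu_N|_p\}=:L<\infty$. Define $i_*=\arg\min_i|\mu_i-\mu|_p$ and $\Psi_*:=\{\psi_{i_*j}: j\ne i_*,\ j\in I_N\}$. Let $\hat\mu:=\mu_{\hat i}$ with $$\hat i:=\arg\min_{i\in I_N}\hat M_i,\qquad\hat M_i:=\max_{\psi\in\Psi}\Big\{\frac1{|\psi|_q}\big(|\Delta_i(\psi)|-\varkappa\varepsilon|\psi|_\Sigma\big)\Big\}.$$ Then $$\mathbb{E}_\mu|\hat\mu-\mu|_p\le\Big(2\max_{\psi\in\Psi_*}|\psi|_q+1\Big)\min_i|\mu_i-\mu|_p+2\varkappa\varepsilon\max_{\psi\in\Psi_*}|\psi|_\Sigma+\gamma+2L\delta .$$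
   Context: Normal means model: one observes $Y=\mu+\varepsilon w$, where $\mu\in\mathbb{R}^n$ is unknown, $\varepsilon\in(0,1)$, $w\sim\mathcal{N}_n(0,\Sigma)$, and $\Sigma$ is the noise correlation matrix. $\mathbb{E}_\mu$ is the expectation under this model. $|\cdot|_p$ is the standard $p$-norm on $\mathbb{R}^n$. $\mu_1,\dots,\mu_N\in\mathbb{R}^n$ are distinct fixed (nonrandom) vectors, $I_N=\{1,\dots,N\}$, $N\ge2$. For $\psi\in\mathbb{R}^n$: $Z(\psi)=\psi^Tw$, $|\psi|_\Sigma^2=\psi^T\Sigma\psi$, and $\Delta_i(\psi)=\psi^TY-\psi^T\mu_i=\psi^T(\mu-\mu_i)+\varepsilon Z(\psi)$. The set $\Psi=\{\psi_{ij}\}$ is $(\gamma,p)$-good if for all $i\neq j$ the vector $\psi_{ij}$ satisfies $\big|\psi_{ij}^T(\mu_i-\mu_j)-|\mu_i-\mu_j|_p\big|\le\gamma$. Conventions: $|\psi|_\Sigma>0$ for all $\psi\in\Psi$; ties in $\arg\min$ are broken arbitrarily (measurably). *)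

theory Defs
  imports "HOL-Probability.Probability"
begin

text \<open>The \<open>p\<close>-norm on \<open>\<real>\<^sup>n\<close> for an exponent \<open>p \<in> [1, \<infinity>]\<close>. Exponents are extended nonnegative
  reals, where \<open>inverse \<infinity> = 0\<close> and \<open>inverse 0 = \<infinity>\<close>, so that \<open>inverse p + inverse q = 1\<close>
  determines the conjugate exponent \<open>q\<close> also in the cases \<open>p = 1\<close> and \<open>p = \<infinity>\<close>.\<close>

definition pnorm :: "ennreal \<Rightarrow> real ^ 'n \<Rightarrow> real" where
  "pnorm p x =
     (if p = \<infinity> then Max (range (\<lambda>k. \<bar>x $ k\<bar>))
      else (\<Sum>k\<in>UNIV. \<bar>x $ k\<bar> powr enn2real p) powr (1 / enn2real p))"

text \<open>The univariate normal law with mean \<open>m\<close> and standard deviation \<open>s \<ge> 0\<close>; for \<open>s = 0\<close> it is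
  the point mass at \<open>m\<close>, since \<^const>\<open>normal_density\<close> is meaningful only for \<open>s > 0\<close>.\<close>

definition normal_law :: "real \<Rightarrow> real \<Rightarrow> real measure" where
  "normal_law m s =
     (if s = 0 then return borel m else density lborel (\<lambda>x. ennreal (normal_density m s x)))"

text \<open>\<open>X \<sim> \<N>\<^sub>n(m, S)\<close>, with possibly singular covariance matrix \<open>S\<close>: every linear combination
  \<open>t\<^sup>T X\<close> is univariate normal with mean \<open>t\<^sup>T m\<close> and variance \<open>t\<^sup>T S t\<close>.\<close>

definition multivariate_normal ::
  "'o measure \<Rightarrow> ('o \<Rightarrow> real ^ 'n) \<Rightarrow> real ^ 'n \<Rightarrow> real ^ 'n ^ 'n \<Rightarrow> bool" where
  "multivariate_normal M X m S \<longleftrightarrow>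
     transpose S = S \<and> (\<forall>t. 0 \<le> t \<bullet> (S *v t)) \<and>
     X \<in> borel_measurable M \<and>
     (\<forall>t. distr M borel (\<lambda>\<omega>. t \<bullet> X \<omega>) = normal_law (t \<bullet> m) (sqrt (t \<bullet> (S *v t))))"

definition Sigma_norm :: "real ^ 'n ^ 'n \<Rightarrow> real ^ 'n \<Rightarrow> real" where
  "Sigma_norm S \<psi> = sqrt (\<psi> \<bullet> (S *v \<psi>))"

definition good_probes ::
  "real \<Rightarrow> ennreal \<Rightarrow> 'i set \<Rightarrow> ('i \<Rightarrow> real ^ 'n) \<Rightarrow> ('i \<Rightarrow> 'i \<Rightarrow> real ^ 'n) \<Rightarrow> bool" where
  "good_probes \<gamma> p I m \<psi> \<longleftrightarrow>
     (\<forall>i\<in>I. \<forall>j\<in>I. i \<noteq> j \<longrightarrow> \<bar>\<psi> i j \<bullet> (m i - m j) - pnorm p (m i - m j)\<bar> \<le> \<gamma>)"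

definition noise_quantile ::
  "'o measure \<Rightarrow> ('o \<Rightarrow> real ^ 'n) \<Rightarrow> real ^ 'n ^ 'n \<Rightarrow> real \<Rightarrow> (real ^ 'n) set \<Rightarrow> real" where
  "noise_quantile M w S \<delta> \<Psi> =
     (LEAST \<kappa>. 0 < \<kappa> \<and>
        measure M {\<omega> \<in> space M. (MAX \<psi>\<in>\<Psi>. \<bar>\<psi> \<bullet> w \<omega>\<bar> / Sigma_norm S \<psi>) \<ge> \<kappa>} \<le> \<delta>)"

text \<open>With data \<open>y\<close> and candidate \<open>c = \<mu>\<^sub>i\<close>, the next two functions are \<open>\<Delta>\<^sub>i(\<psi>)\<close> and the
  selection statistic minimised over \<open>i\<close>.\<close>

definition Delta :: "real ^ 'n \<Rightarrow> real ^ 'n \<Rightarrow> real ^ 'n \<Rightarrow> real" where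
  "Delta y c \<psi> = \<psi> \<bullet> y - \<psi> \<bullet> c"

definition selection_stat ::
  "ennreal \<Rightarrow> real ^ 'n ^ 'n \<Rightarrow> real \<Rightarrow> real \<Rightarrow> (real ^ 'n) set \<Rightarrow> real ^ 'n \<Rightarrow> real ^ 'n \<Rightarrow> real" where
  "selection_stat q S \<kappa> \<epsilon> \<Psi> y c =
     (MAX \<psi>\<in>\<Psi>. 1 / pnorm q \<psi> * (\<bar>Delta y c \<psi>\<bar> - \<kappa> * \<epsilon> * Sigma_norm S \<psi>))"

end

theory Submission
  imports Defs
begin

text \<open>The selection rule is analysed on the event where every normalised noise
  \<open>\<bar>Z(v)\<bar> / \<bar>v\<bar>\<^sub>\<Sigma>\<close> is below \<open>\<kappa>\<close>. Write \<open>r\<close> for the distance from \<open>\<mu>\<close> to the nearest candidate \<open>c\<close>.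
  Hoelder's inequality gives \<open>\<bar>\<Delta>\<^sub>c(v)\<bar> \<le> \<bar>v\<bar>\<^sub>q r + \<kappa> \<epsilon> \<bar>v\<bar>\<^sub>\<Sigma>\<close> for every probe \<open>v\<close>, which says exactly
  that the statistic of \<open>c\<close> is at most \<open>r\<close>. The selected vector \<open>d\<close> minimises the statistic, so its
  residuals satisfy the same bound. Subtracting the two residuals at the one probe that was built to
  separate \<open>c\<close> from \<open>d\<close> cancels the data and leaves \<open>v \<bullet> (c - d)\<close>, which is the distance
  between \<open>c\<close> and \<open>d\<close> up to \<open>\<gamma>\<close>; the triangle inequality then yields the bound with the factor
  \<open>2 \<bar>v\<bar>\<^sub>q + 1\<close> (\<open>selected_close_to_oracle\<close>).

  Off this event the loss is still at most \<open>2 L\<close>, by the triangle inequality again, so the event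
  costs \<open>2 L \<delta>\<close> in expectation (\<open>expectation_le_split\<close>), provided its complement really has
  probability at most \<open>\<delta>\<close>. This requires that the minimum defining \<open>\<kappa>\<close> is attained and positive:
  the maximum of the normalised noises has no atoms because each of them is a nondegenerate normal
  variable in absolute value, hence its distribution function is continuous
  (\<open>noise_quantile_attained\<close>).

  The two analytic ingredients, the Hoelder and Minkowski inequalities for all exponents in
  \<open>[1, \<infinity>]\<close>, follow from Young's inequality and from convexity of powers, respectively, after
  normalising both vectors to unit norm.\<close>

section \<open>Finite-dimensional p-norms\<close>

lemma pnorm_finite:
  assumes "0 \<le> r"
  shows "pnorm (ennreal r) x = (\<Sum>k\<in>UNIV. \<bar>x $ k\<bar> powr r) powr (1 / r)"
  using assms by (simp add: pnorm_def)

lemma abs_nth_le_pnorm_top: "\<bar>x $ k\<bar> \<le> pnorm \<infinity> x"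
  by (simp add: pnorm_def)

lemma pnorm_nonneg: "0 \<le> pnorm p x"
proof (cases "p = \<infinity>")
  case True
  then show ?thesis
    using abs_nth_le_pnorm_top[of x undefined] by (metis abs_ge_zero order_trans)
qed (simp add: pnorm_def)

lemma pnorm_minus: "pnorm p (- x) = pnorm p x"
  by (simp add: pnorm_def)

lemma pnorm_minus_commute: "pnorm p (x - y) = pnorm p (y - x)"
  by (metis pnorm_minus minus_diff_eq)

lemma pnorm_pos:
  assumes "x \<noteq> 0"
  shows "0 < pnorm p x"
proof -
  obtain k where k: "x $ k \<noteq> 0"
    using assms by (auto simp: vec_eq_iff)
  show ?thesis
  proof (cases "p = \<infinity>")
    case True
    then show ?thesis
      using abs_nth_le_pnorm_top[of x k] k by auto
  next
    case False
    have "0 < (\<Sum>k\<in>UNIV. \<bar>x $ k\<bar> powr enn2real p)"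
      using k by (intro sum_pos2[of _ k]) auto
    with False show ?thesis
      by (simp add: pnorm_def)
  qed
qed

lemma pnorm_powr:
  assumes "1 \<le> r"
  shows "pnorm (ennreal r) x powr r = (\<Sum>k\<in>UNIV. \<bar>x $ k\<bar> powr r)"
  using assms by (simp add: pnorm_finite powr_powr sum_nonneg)

text \<open>Both inequalities for finite exponents are proved termwise for unit vectors; this identity turns
  the sum of the termwise bounds into the constant \<open>1\<close>.\<close>

lemma sum_normalized_powr:
  assumes "1 \<le> r" "x \<noteq> 0"
  shows "(\<Sum>k\<in>UNIV. (\<bar>x $ k\<bar> / pnorm (ennreal r) x) powr r) = 1"
proof -
  have pos: "0 < pnorm (ennreal r) x"
    using assms by (simp add: pnorm_pos)
  have "(\<Sum>k\<in>UNIV. (\<bar>x $ k\<bar> / pnorm (ennreal r) x) powr r)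
      = (\<Sum>k\<in>UNIV. \<bar>x $ k\<bar> powr r) / pnorm (ennreal r) x powr r"
    using pos by (simp add: powr_divide sum_divide_distrib)
  also have "\<dots> = 1"
    using pos assms by (simp flip: pnorm_powr)
  finally show ?thesis .
qed

text \<open>Coordinates may vanish, so convexity of \<open>x powr r\<close> on the open half-line has to be extended to
  \<open>0\<close>. There it reduces to \<open>u powr r \<le> u\<close> for \<open>u \<in> [0, 1]\<close>.\<close>

lemma powr_convex_nonneg:
  fixes a b s t r :: real
  assumes "1 \<le> r" "0 \<le> a" "0 \<le> b" "0 \<le> s" "0 \<le> t" "s + t = 1"
  shows "(s * a + t * b) powr r \<le> s * a powr r + t * b powr r"
proof -
  have shrink: "(u * c) powr r \<le> u * c powr r" if "0 \<le> u" "u \<le> 1" "0 \<le> c" for u c :: real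
  proof -
    have "u powr r \<le> u"
      using powr_mono'[of 1 r u] that assms by simp
    then show ?thesis
      using that by (simp add: powr_mult mult_right_mono)
  qed
  consider "a = 0" | "b = 0" | "0 < a" "0 < b"
    using assms by linarith
  then show ?thesis
  proof cases
    case 3
    then show ?thesis
      using powr_convex[OF assms(1)] assms by (auto simp: convex_on_def)
  qed (use shrink[of s a] shrink[of t b] assms in auto)
qed

text \<open>With \<open>A\<close>, \<open>B\<close> the two norms, \<open>(\<bar>x $ k\<bar> + \<bar>y $ k\<bar>) / (A + B)\<close> is a convex combination, with
  weights independent of \<open>k\<close>, of the coordinates of two unit vectors. Convexity of the power
  therefore keeps the sum of its \<open>r\<close>-th powers below \<open>1\<close>.\<close>

lemma pnorm_triangle_finite:
  assumes r: "1 \<le> r"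
  shows "pnorm (ennreal r) (x + y) \<le> pnorm (ennreal r) x + pnorm (ennreal r) y"
proof (cases "x = 0 \<or> y = 0")
  case True
  then show ?thesis
    by (auto simp: pnorm_nonneg)
next
  case False
  define A B where "A = pnorm (ennreal r) x" and "B = pnorm (ennreal r) y"
  have pos: "0 < A" "0 < B"
    using False by (auto simp: A_def B_def pnorm_pos)
  define s t where "s = A / (A + B)" and "t = B / (A + B)"
  have st: "0 \<le> s" "0 \<le> t" "s + t = 1"
    using pos by (auto simp: s_def t_def simp flip: add_divide_distrib)
  have split: "\<bar>x $ k\<bar> + \<bar>y $ k\<bar> = (A + B) * (s * (\<bar>x $ k\<bar> / A) + t * (\<bar>y $ k\<bar> / B))" for k
    using pos by (simp add: s_def t_def distrib_left)
  have "pnorm (ennreal r) (x + y) powr r = (\<Sum>k\<in>UNIV. \<bar>x $ k + y $ k\<bar> powr r)"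
    using r by (simp add: pnorm_powr)
  also have "\<dots> \<le> (\<Sum>k\<in>UNIV. (\<bar>x $ k\<bar> + \<bar>y $ k\<bar>) powr r)"
    using r by (intro sum_mono powr_mono2) auto
  also have "\<dots> = (A + B) powr r * (\<Sum>k\<in>UNIV. (s * (\<bar>x $ k\<bar> / A) + t * (\<bar>y $ k\<bar> / B)) powr r)"
    unfolding split sum_distrib_left by (simp only: powr_mult)
  also have "\<dots> \<le> (A + B) powr r *
      (\<Sum>k\<in>UNIV. s * (\<bar>x $ k\<bar> / A) powr r + t * (\<bar>y $ k\<bar> / B) powr r)"
    using r st pos by (intro mult_left_mono sum_mono powr_convex_nonneg) auto
  also have "\<dots> = (A + B) powr r"
    using sum_normalized_powr[OF r, of x] sum_normalized_powr[OF r, of y] False st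
    by (simp add: sum.distrib A_def B_def flip: sum_distrib_left)
  finally show ?thesis
    using r pos pnorm_nonneg[of "ennreal r" "x + y"]
    by (smt (verit) A_def B_def powr_less_mono2)
qed

lemma pnorm_triangle:
  assumes "1 \<le> p"
  shows "pnorm p (x + y) \<le> pnorm p x + pnorm p y"
proof (cases p)
  case (real r)
  then show ?thesis
    using assms pnorm_triangle_finite[of r x y] by simp
next
  case top
  have "\<bar>x $ k + y $ k\<bar> \<le> pnorm \<infinity> x + pnorm \<infinity> y" for k
    using abs_nth_le_pnorm_top[of x k] abs_nth_le_pnorm_top[of y k] by linarith
  then have "pnorm \<infinity> (x + y) \<le> pnorm \<infinity> x + pnorm \<infinity> y"
    by (subst pnorm_def) simp
  then show ?thesis
    using top by simp
qed

lemma pnorm_Hoelder_1_top: "\<bar>x \<bullet> y\<bar> \<le> pnorm 1 x * pnorm \<infinity> y"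
proof -
  have "\<bar>x \<bullet> y\<bar> \<le> (\<Sum>k\<in>UNIV. \<bar>x $ k * y $ k\<bar>)"
    unfolding inner_vec_def by (simp add: sum_abs)
  also have "\<dots> \<le> (\<Sum>k\<in>UNIV. \<bar>x $ k\<bar> * pnorm \<infinity> y)"
    unfolding abs_mult by (intro sum_mono mult_left_mono abs_nth_le_pnorm_top) auto
  also have "\<dots> = pnorm 1 x * pnorm \<infinity> y"
    by (simp add: pnorm_def sum_distrib_right sum_nonneg)
  finally show ?thesis .
qed

lemma pnorm_Hoelder_finite:
  assumes rs: "1 < r" "1 < s" "1 / r + 1 / s = 1"
  shows "\<bar>x \<bullet> y\<bar> \<le> pnorm (ennreal r) x * pnorm (ennreal s) y"
proof (cases "x = 0 \<or> y = 0")
  case True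
  then show ?thesis
    by (auto simp: pnorm_nonneg)
next
  case False
  define A B where "A = pnorm (ennreal r) x" and "B = pnorm (ennreal s) y"
  have pos: "0 < A" "0 < B"
    using False by (auto simp: A_def B_def pnorm_pos)
  have "\<bar>x \<bullet> y\<bar> \<le> (\<Sum>k\<in>UNIV. \<bar>x $ k * y $ k\<bar>)"
    unfolding inner_vec_def by (simp add: sum_abs)
  also have "\<dots> = A * B * (\<Sum>k\<in>UNIV. (\<bar>x $ k\<bar> / A) * (\<bar>y $ k\<bar> / B))"
    using pos by (simp add: sum_distrib_left abs_mult)
  also have "\<dots> \<le> A * B * (\<Sum>k\<in>UNIV. (\<bar>x $ k\<bar> / A) powr r / r + (\<bar>y $ k\<bar> / B) powr s / s)"
    using pos rs by (intro mult_left_mono sum_mono Youngs_inequality) auto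
  also have "\<dots> = A * B"
    using sum_normalized_powr[of r x] sum_normalized_powr[of s y] False rs
    by (simp add: sum.distrib A_def B_def flip: sum_divide_distrib)
  finally show ?thesis
    by (simp add: A_def B_def)
qed

lemma ennreal_inverse_eq_1:
  fixes a :: ennreal
  assumes "inverse a = 1"
  shows "a = 1"
proof (cases a)
  case (real r)
  with assms have "0 < r"
    by (cases "r = 0") auto
  then show ?thesis
    using assms real by (simp add: inverse_ennreal)
qed (use assms in simp)

text \<open>Conjugate extended exponents are either the pair \<open>1, \<infinity>\<close> in some order or two reals to
  which Young's inequality applies.\<close>

lemma conjugate_exponent_cases:
  fixes p q :: ennreal
  assumes "1 \<le> p" "inverse p + inverse q = 1"
  obtains "p = 1" "q = \<infinity>"
  | "p = \<infinity>" "q = 1"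
  | r s where "p = ennreal r" "q = ennreal s" "1 < r" "1 < s" "1 / r + 1 / s = 1"
proof (cases p)
  case top
  then have "inverse q = 1"
    using assms by simp
  then have "q = 1"
    by (rule ennreal_inverse_eq_1)
  then show ?thesis
    using that(2) top by simp
next
  case (real r)
  have r: "1 \<le> r"
    using real assms by simp
  show ?thesis
  proof (cases q)
    case top
    then have "inverse p = 1"
      using assms by simp
    then show ?thesis
      using that(1) top ennreal_inverse_eq_1 by simp
  next
    case (real s)
    have "s \<noteq> 0"
      using assms real by auto
    then have s: "0 < s"
      using real by simp
    have "ennreal (1 / r + 1 / s) = ennreal 1"
      using assms(2) r s real \<open>p = ennreal r\<close>
      by (simp add: inverse_ennreal inverse_eq_divide)
    then have eq: "1 / r + 1 / s = 1"
      using r s by (subst (asm) ennreal_inj) auto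
    moreover have "1 / r < 1" "1 / s < 1"
      using eq r s by (smt (verit) divide_pos_pos)+
    ultimately show ?thesis
      using that(3)[OF \<open>p = ennreal r\<close> real(2)] r s by (simp add: divide_less_eq)
  qed
qed

lemma pnorm_Hoelder:
  assumes "1 \<le> p" "inverse p + inverse q = 1"
  shows "\<bar>x \<bullet> y\<bar> \<le> pnorm q x * pnorm p y"
  using assms
proof (cases rule: conjugate_exponent_cases)
  case 1
  then show ?thesis
    using pnorm_Hoelder_1_top[of y x] by (simp add: inner_commute mult.commute)
next
  case 2
  then show ?thesis
    using pnorm_Hoelder_1_top[of x y] by simp
next
  case (3 r s)
  then show ?thesis
    using pnorm_Hoelder_finite[of r s y x] by (simp add: inner_commute mult.commute)
qed

section \<open>The noise quantile\<close>

text \<open>Without atoms the upper tail is the complement of the distribution function \<open>F\<close>, and \<open>F\<close> is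
  continuous. Hence the admissible thresholds form the closed set \<open>F \<ge> 1 - \<delta>\<close>, which contains its
  infimum; it is nonempty since \<open>F\<close> tends to \<open>1\<close>, and it lies in \<open>{0<..}\<close> since a nonnegative
  variable is at least \<open>x\<close>, for any \<open>x \<le> 0\<close>, with probability \<open>1 > \<delta>\<close>.\<close>

lemma (in prob_space) upper_quantile_attained:
  fixes X :: "'a \<Rightarrow> real"
  assumes X[measurable]: "random_variable borel X"
    and nonneg: "\<And>\<omega>. \<omega> \<in> space M \<Longrightarrow> 0 \<le> X \<omega>"
    and atomless: "\<And>c. prob {\<omega> \<in> space M. X \<omega> = c} = 0"
    and \<delta>: "0 < \<delta>" "\<delta> < 1"
  defines "k \<equiv> LEAST k. 0 < k \<and> prob {\<omega> \<in> space M. k \<le> X \<omega>} \<le> \<delta>"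
  shows "0 < k \<and> prob {\<omega> \<in> space M. k \<le> X \<omega>} \<le> \<delta>"
proof -
  interpret D: real_distribution "distr M borel X"
    by (rule real_distribution_distr) simp
  let ?F = "cdf (distr M borel X)"
  define K where "K = {x. 1 - \<delta> \<le> ?F x}"
  have F: "?F x = 1 - prob {\<omega> \<in> space M. x \<le> X \<omega>}" for x
  proof -
    have "?F x = prob {\<omega> \<in> space M. X \<omega> < x} + prob {\<omega> \<in> space M. X \<omega> = x}"
      unfolding cdf_def
      by (subst finite_measure_Union[symmetric]) (auto simp: measure_distr intro!: arg_cong[where f=prob])
    also have "prob {\<omega> \<in> space M. X \<omega> < x} = prob (space M - {\<omega> \<in> space M. x \<le> X \<omega>})"
      by (intro arg_cong[where f=prob]) auto
    finally show ?thesis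
      by (simp add: atomless prob_compl)
  qed
  have cont: "continuous_on UNIV ?F"
    unfolding continuous_on_eq_continuous_at[OF open_UNIV] D.isCont_cdf
    using atomless by (auto simp: measure_distr vimage_def Int_def conj_commute)
  have "closed K"
    unfolding K_def by (intro closed_Collect_le continuous_intros cont)
  have pos: "0 < x" if "x \<in> K" for x
  proof (rule ccontr)
    assume "\<not> 0 < x"
    then have "{\<omega> \<in> space M. x \<le> X \<omega>} = space M"
      using nonneg by fastforce
    with F[of x] that \<delta> show False
      by (simp add: K_def prob_space)
  qed
  have "\<forall>\<^sub>F x in at_top. 1 - \<delta> < ?F x"
    using D.cdf_lim_at_top_prob \<delta> by (intro order_tendstoD) auto
  then have "K \<noteq> {}"
    by (auto simp: K_def eventually_at_top_linorder intro: less_imp_le)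
  moreover have bdd: "bdd_below K"
    using pos by (intro bdd_belowI[of _ 0]) (auto intro: less_imp_le)
  ultimately have Inf: "Inf K \<in> K"
    using \<open>closed K\<close> by (rule closed_contains_Inf)
  have K: "x \<in> K \<longleftrightarrow> 0 < x \<and> prob {\<omega> \<in> space M. x \<le> X \<omega>} \<le> \<delta>" for x
    using pos[of x] F[of x] by (auto simp: K_def)
  have "k = Inf K"
    unfolding k_def K[symmetric] using Inf bdd by (intro Least_equality cInf_lower) auto
  then show ?thesis
    using Inf K by simp
qed

lemma normal_law_atomless:
  assumes "0 < s"
  shows "measure (normal_law m s) {a} = 0"
  using assms
  by (simp add: normal_law_def measure_def emeasure_density nn_integral_indicator_singleton)

lemma (in prob_space) normal_linear_form_atomless:
  assumes "multivariate_normal M w 0 S" "0 < Sigma_norm S v"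
  shows "prob {\<omega> \<in> space M. v \<bullet> w \<omega> = a} = 0"
proof -
  have [measurable]: "w \<in> borel_measurable M"
    using assms(1) by (simp add: multivariate_normal_def)
  have "prob {\<omega> \<in> space M. v \<bullet> w \<omega> = a} = measure (distr M borel (\<lambda>\<omega>. v \<bullet> w \<omega>)) {a}"
    by (subst measure_distr) (auto intro!: arg_cong[where f=prob])
  also have "\<dots> = 0"
    using assms by (simp add: multivariate_normal_def Sigma_norm_def normal_law_atomless)
  finally show ?thesis .
qed

text \<open>If the maximum equals \<open>c\<close>, then one of the finitely many linear forms \<open>v \<bullet> w\<close> equals
  \<open>c\<close> or \<open>- c\<close> times its standard deviation, which is a null event. So the maximum is atomless and
  the quantile is attained.\<close>

lemma (in prob_space) noise_quantile_attained:
  assumes normal: "multivariate_normal M w 0 S"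
    and \<Psi>: "finite \<Psi>" "\<Psi> \<noteq> {}" "\<forall>v\<in>\<Psi>. 0 < Sigma_norm S v"
    and \<delta>: "0 < \<delta>" "\<delta> < 1"
  defines "\<kappa> \<equiv> noise_quantile M w S \<delta> \<Psi>"
  shows "0 < \<kappa> \<and> prob {\<omega> \<in> space M. \<kappa> \<le> (MAX v\<in>\<Psi>. \<bar>v \<bullet> w \<omega>\<bar> / Sigma_norm S v)} \<le> \<delta>"
proof -
  have w[measurable]: "w \<in> borel_measurable M"
    using normal by (simp add: multivariate_normal_def)
  define X where "X \<omega> = (MAX v\<in>\<Psi>. \<bar>v \<bullet> w \<omega>\<bar> / Sigma_norm S v)" for \<omega>
  have meas[measurable]: "random_variable borel X"
    unfolding X_def[abs_def] using \<Psi>(1) by (intro borel_measurable_Max) measurable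
  have nonneg: "0 \<le> X \<omega>" for \<omega>
  proof -
    obtain v where "v \<in> \<Psi>" using \<Psi>(2) by blast
    then have "0 \<le> \<bar>v \<bullet> w \<omega>\<bar> / Sigma_norm S v" "\<bar>v \<bullet> w \<omega>\<bar> / Sigma_norm S v \<le> X \<omega>"
      using \<Psi> by (auto simp: X_def intro!: Max_ge divide_nonneg_pos)
    then show ?thesis by linarith
  qed
  have atomless: "prob {\<omega> \<in> space M. X \<omega> = c} = 0" for c
  proof -
    define E where "E v = {\<omega> \<in> space M. v \<bullet> w \<omega> = c * Sigma_norm S v}
        \<union> {\<omega> \<in> space M. v \<bullet> w \<omega> = - (c * Sigma_norm S v)}" for v
    have [measurable]: "E v \<in> events" for v
      unfolding E_def by measurable
    have "E v \<in> null_sets M" if "v \<in> \<Psi>" for v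
      unfolding E_def using normal_linear_form_atomless[OF normal] \<Psi>(3) that
      by (intro null_sets.Un) (auto simp: null_sets_def emeasure_eq_measure)
    then have null: "(\<Union>v\<in>\<Psi>. E v) \<in> null_sets M"
      using \<Psi>(1) by (intro null_sets_UN') (auto intro: countable_finite)
    have "{\<omega> \<in> space M. X \<omega> = c} \<subseteq> (\<Union>v\<in>\<Psi>. E v)"
    proof
      fix \<omega> assume \<omega>: "\<omega> \<in> {\<omega> \<in> space M. X \<omega> = c}"
      have "X \<omega> \<in> (\<lambda>v. \<bar>v \<bullet> w \<omega>\<bar> / Sigma_norm S v) ` \<Psi>"
        unfolding X_def using \<Psi> by (intro Max_in) auto
      then obtain v where v: "v \<in> \<Psi>" "X \<omega> = \<bar>v \<bullet> w \<omega>\<bar> / Sigma_norm S v"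
        by blast
      then have "\<bar>v \<bullet> w \<omega>\<bar> = c * Sigma_norm S v"
        using \<omega> \<Psi>(3) by (auto simp: field_simps)
      then have "\<omega> \<in> E v"
        using \<omega> by (auto simp: E_def)
      then show "\<omega> \<in> (\<Union>v\<in>\<Psi>. E v)"
        using v by blast
    qed
    then have "{\<omega> \<in> space M. X \<omega> = c} \<in> null_sets M"
      by (intro null_sets_subset[OF null]) measurable
    then show ?thesis
      by (simp add: measure_def null_setsD1)
  qed
  show ?thesis
    using upper_quantile_attained[OF meas nonneg atomless \<delta>]
    by (simp add: \<kappa>_def noise_quantile_def X_def)
qed

section \<open>The selection rule on the good event\<close>

lemma Delta_noise_bound:
  assumes pq: "1 \<le> p" "inverse p + inverse q = 1"
    and \<epsilon>: "0 \<le> \<epsilon>"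
    and noise: "\<bar>v \<bullet> z\<bar> \<le> \<kappa> * Sigma_norm S v"
  shows "\<bar>Delta (\<mu> + \<epsilon> *\<^sub>R z) c v\<bar> \<le> pnorm q v * pnorm p (c - \<mu>) + \<kappa> * \<epsilon> * Sigma_norm S v"
proof -
  have "Delta (\<mu> + \<epsilon> *\<^sub>R z) c v = v \<bullet> (\<mu> - c) + \<epsilon> * (v \<bullet> z)"
    by (simp add: Delta_def inner_simps)
  moreover have "\<bar>v \<bullet> (\<mu> - c)\<bar> \<le> pnorm q v * pnorm p (c - \<mu>)"
    using pnorm_Hoelder[OF pq] by (metis pnorm_minus_commute)
  moreover have "\<bar>\<epsilon> * (v \<bullet> z)\<bar> \<le> \<kappa> * \<epsilon> * Sigma_norm S v"
    using mult_left_mono[OF noise \<epsilon>] \<epsilon> by (simp add: abs_mult ac_simps)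
  ultimately show ?thesis
    by linarith
qed

text \<open>The weights \<open>1 / pnorm q v\<close> are what makes the statistic comparable to a distance: bounding it
  by \<open>b\<close> is the same as bounding all residuals as if the candidate were at distance \<open>b\<close> from the
  truth.\<close>

lemma selection_stat_le_iff:
  assumes "finite \<Psi>" "\<Psi> \<noteq> {}" "\<And>v. v \<in> \<Psi> \<Longrightarrow> v \<noteq> 0"
  shows "selection_stat q S \<kappa> \<epsilon> \<Psi> y c \<le> b \<longleftrightarrow>
    (\<forall>v\<in>\<Psi>. \<bar>Delta y c v\<bar> \<le> pnorm q v * b + \<kappa> * \<epsilon> * Sigma_norm S v)"
proof -
  have "1 / pnorm q v * (d - e) \<le> b \<longleftrightarrow> d \<le> pnorm q v * b + e" if "v \<in> \<Psi>" for v and d e :: real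
    using pnorm_pos[OF assms(3)[OF that], of q] by (simp add: field_simps)
  then show ?thesis
    using assms by (simp add: selection_stat_def)
qed

text \<open>Here \<open>c\<close> is the reference candidate, \<open>d\<close> the selected one and \<open>v\<close> the probe assigned to the
  pair. Both statistics are at most the distance from \<open>c\<close> to \<open>\<mu>\<close>, so both residuals at
  \<open>v\<close> are controlled, and their difference is \<open>v \<bullet> (c - d)\<close>, free of \<open>\<mu>\<close> and of the noise.\<close>

lemma selected_close_to_oracle:
  assumes pq: "1 \<le> p" "inverse p + inverse q = 1"
    and \<epsilon>: "0 \<le> \<epsilon>"
    and \<Psi>: "finite \<Psi>" "\<Psi> \<noteq> {}" "\<And>v. v \<in> \<Psi> \<Longrightarrow> v \<noteq> 0"
    and noise: "\<And>v. v \<in> \<Psi> \<Longrightarrow> \<bar>v \<bullet> z\<bar> \<le> \<kappa> * Sigma_norm S v"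
    and v: "v \<in> \<Psi>" "\<bar>v \<bullet> (c - d) - pnorm p (c - d)\<bar> \<le> \<gamma>"
    and sel: "selection_stat q S \<kappa> \<epsilon> \<Psi> (\<mu> + \<epsilon> *\<^sub>R z) d \<le> selection_stat q S \<kappa> \<epsilon> \<Psi> (\<mu> + \<epsilon> *\<^sub>R z) c"
  shows "pnorm p (d - \<mu>)
    \<le> (2 * pnorm q v + 1) * pnorm p (c - \<mu>) + 2 * \<kappa> * \<epsilon> * Sigma_norm S v + \<gamma>"
proof -
  let ?y = "\<mu> + \<epsilon> *\<^sub>R z" and ?r = "pnorm p (c - \<mu>)"
  have at_c: "\<bar>Delta ?y c u\<bar> \<le> pnorm q u * ?r + \<kappa> * \<epsilon> * Sigma_norm S u" if "u \<in> \<Psi>" for u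
    using Delta_noise_bound[OF pq \<epsilon> noise[OF that]] .
  then have "selection_stat q S \<kappa> \<epsilon> \<Psi> ?y c \<le> ?r"
    by (subst selection_stat_le_iff[OF \<Psi>]) auto
  with sel have "selection_stat q S \<kappa> \<epsilon> \<Psi> ?y d \<le> ?r"
    by linarith
  then have "\<bar>Delta ?y d v\<bar> \<le> pnorm q v * ?r + \<kappa> * \<epsilon> * Sigma_norm S v"
    using v(1) by (subst (asm) selection_stat_le_iff[OF \<Psi>]) auto
  moreover have "v \<bullet> (c - d) = Delta ?y d v - Delta ?y c v"
    by (simp add: Delta_def inner_simps)
  moreover have "pnorm p (c - d) \<le> v \<bullet> (c - d) + \<gamma>"
    using v(2) by auto
  ultimately have "pnorm p (c - d) \<le> 2 * (pnorm q v * ?r + \<kappa> * \<epsilon> * Sigma_norm S v) + \<gamma>"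
    using at_c[OF v(1)] unfolding abs_le_iff distrib_left by linarith
  moreover have "pnorm p (d - \<mu>) \<le> pnorm p (c - d) + ?r"
    using pnorm_triangle[OF pq(1), of "d - c" "c - \<mu>"] pnorm_minus_commute[of p d c] by simp
  ultimately show ?thesis
    by (simp add: algebra_simps)
qed

section \<open>Risk of the selected vector\<close>

lemma (in prob_space) expectation_le_split:
  fixes f :: "'a \<Rightarrow> real"
  assumes [measurable]: "f \<in> borel_measurable M" "A \<in> events"
    and nonneg: "\<And>\<omega>. \<omega> \<in> space M \<Longrightarrow> 0 \<le> f \<omega>"
    and le: "\<And>\<omega>. \<omega> \<in> space M \<Longrightarrow> f \<omega> \<le> C"
    and off: "\<And>\<omega>. \<omega> \<in> space M - A \<Longrightarrow> f \<omega> \<le> B"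
    and "0 \<le> B" "prob A \<le> \<delta>"
  shows "expectation f \<le> B + C * \<delta>"
proof -
  obtain \<omega> where "\<omega> \<in> space M"
    using not_empty by blast
  then have C: "0 \<le> C"
    using nonneg le by force
  have "integrable M f"
    using nonneg le by (intro integrable_const_bound[of _ C]) (auto intro!: AE_I2)
  moreover have "f \<omega> \<le> B + C * indicator A \<omega>" if "\<omega> \<in> space M" for \<omega>
    using le[OF that] off[of \<omega>] that \<open>0 \<le> B\<close> by (cases "\<omega> \<in> A") auto
  ultimately have "expectation f \<le> expectation (\<lambda>\<omega>. B + C * indicator A \<omega>)"
    by (intro integral_mono) (auto simp: less_top[symmetric])
  also have "\<dots> = B + C * prob A"
    by (simp add: less_top[symmetric] prob_space)
  also have "\<dots> \<le> B + C * \<delta>"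
    using C assms by (intro add_left_mono mult_left_mono) auto
  finally show ?thesis .
qed

theorem theorem6:
  fixes M :: "'o measure"
    and w Y :: "'o \<Rightarrow> real ^ 'n"
    and S :: "real ^ 'n ^ 'n"
    and \<mu> :: "real ^ 'n"
    and m :: "nat \<Rightarrow> real ^ 'n"
    and \<psi> :: "nat \<Rightarrow> nat \<Rightarrow> real ^ 'n"
    and \<Psi> \<Psi>s :: "(real ^ 'n) set"
    and p q :: ennreal
    and \<epsilon> \<gamma> \<delta> \<kappa> L :: real
    and N istar :: nat
    and ihat :: "'o \<Rightarrow> nat"
  assumes "prob_space M"
    and "0 < \<epsilon>" "\<epsilon> < 1"
    and "multivariate_normal M w 0 S"
    and "Y = (\<lambda>\<omega>. \<mu> + \<epsilon> *\<^sub>R w \<omega>)"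
    and "2 \<le> N"
    and "inj_on m {1..N}"
    and "1 \<le> p" "inverse p + inverse q = 1"
    and "0 \<le> \<gamma>"
    and "\<Psi> = {\<psi> i j | i j. i \<in> {1..N} \<and> j \<in> {1..N} \<and> i \<noteq> j}"
    and "\<forall>v\<in>\<Psi>. 0 < Sigma_norm S v"
    and "good_probes \<gamma> p {1..N} m \<psi>"
    and "0 < \<delta>" "\<delta> < 1"
    and "\<kappa> = noise_quantile M w S \<delta> \<Psi>"
    and "L = Max (insert (pnorm p \<mu>) ((\<lambda>i. pnorm p (m i)) ` {1..N}))"
    and "is_arg_min (\<lambda>i. pnorm p (m i - \<mu>)) (\<lambda>i. i \<in> {1..N}) istar"
    and "\<Psi>s = {\<psi> istar j | j. j \<in> {1..N} \<and> j \<noteq> istar}"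
    and "ihat \<in> measurable M (count_space UNIV)"
    and "\<And>\<omega>. \<omega> \<in> space M \<Longrightarrow>
           is_arg_min (\<lambda>i. selection_stat q S \<kappa> \<epsilon> \<Psi> (Y \<omega>) (m i)) (\<lambda>i. i \<in> {1..N}) (ihat \<omega>)"
  shows "prob_space.expectation M (\<lambda>\<omega>. pnorm p (m (ihat \<omega>) - \<mu>))
    \<le> (2 * (MAX v\<in>\<Psi>s. pnorm q v) + 1) * (MIN i\<in>{1..N}. pnorm p (m i - \<mu>))
       + 2 * \<kappa> * \<epsilon> * (MAX v\<in>\<Psi>s. Sigma_norm S v) + \<gamma> + 2 * L * \<delta>"
proof -
  interpret prob_space M by fact
  let ?I = "{1..N}"
  let ?dist = "\<lambda>i. pnorm p (m i - \<mu>)"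
  let ?bad = "{\<omega> \<in> space M. \<kappa> \<le> (MAX v\<in>\<Psi>. \<bar>v \<bullet> w \<omega>\<bar> / Sigma_norm S v)}"
  let ?B = "(2 * (MAX v\<in>\<Psi>s. pnorm q v) + 1) * ?dist istar
       + 2 * \<kappa> * \<epsilon> * (MAX v\<in>\<Psi>s. Sigma_norm S v) + \<gamma>"
  note \<Psi>_def = \<open>\<Psi> = _\<close> and \<Psi>s_def = \<open>\<Psi>s = _\<close>
  have istar: "istar \<in> ?I" "\<And>i. i \<in> ?I \<Longrightarrow> ?dist istar \<le> ?dist i"
    using \<open>is_arg_min _ _ istar\<close> by (auto simp: is_arg_min_def not_less)
  have ihat: "ihat \<omega> \<in> ?I"
    "selection_stat q S \<kappa> \<epsilon> \<Psi> (Y \<omega>) (m (ihat \<omega>)) \<le> selection_stat q S \<kappa> \<epsilon> \<Psi> (Y \<omega>) (m istar)"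
    if "\<omega> \<in> space M" for \<omega>
    using assms(21)[OF that] istar(1) by (auto simp: is_arg_min_def not_less)
  have best: "(MIN i\<in>?I. ?dist i) = ?dist istar"
    using istar by (intro Min_eqI) auto
  have "\<Psi>s \<subseteq> \<Psi>"
    using istar(1) by (auto simp: \<Psi>_def \<Psi>s_def)
  have "\<Psi> \<subseteq> (\<lambda>(i, j). \<psi> i j) ` (?I \<times> ?I)"
    by (auto simp: \<Psi>_def)
  then have fin: "finite \<Psi>"
    by (rule finite_subset) simp
  then have fins: "finite \<Psi>s"
    using \<open>\<Psi>s \<subseteq> \<Psi>\<close> by (rule finite_subset[rotated])
  obtain j where "j \<in> ?I" "j \<noteq> istar"
    using \<open>2 \<le> N\<close> by (cases "istar = 1") (auto intro: that[of 1] that[of 2])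
  then have nes: "\<Psi>s \<noteq> {}"
    by (auto simp: \<Psi>s_def)
  then have ne: "\<Psi> \<noteq> {}"
    using \<open>\<Psi>s \<subseteq> \<Psi>\<close> by blast
  have nz: "v \<noteq> 0" if "v \<in> \<Psi>" for v
    using \<open>\<forall>v\<in>\<Psi>. 0 < Sigma_norm S v\<close> that by (auto simp: Sigma_norm_def)
  have \<kappa>: "0 < \<kappa>" "prob ?bad \<le> \<delta>"
    using noise_quantile_attained[OF \<open>multivariate_normal M w 0 S\<close> fin ne
        \<open>\<forall>v\<in>\<Psi>. 0 < Sigma_norm S v\<close> \<open>0 < \<delta>\<close> \<open>\<delta> < 1\<close>]
    unfolding \<open>\<kappa> = _\<close> by auto
  have max_q: "pnorm q v \<le> (MAX v\<in>\<Psi>s. pnorm q v)"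
    and max_S: "Sigma_norm S v \<le> (MAX v\<in>\<Psi>s. Sigma_norm S v)" if "v \<in> \<Psi>s" for v
    using that fins by auto
  have max_nonneg: "0 \<le> (MAX v\<in>\<Psi>s. pnorm q v)" "0 \<le> (MAX v\<in>\<Psi>s. Sigma_norm S v)"
  proof -
    obtain v where v: "v \<in> \<Psi>s" using nes by blast
    then have "0 < Sigma_norm S v"
      using \<open>\<Psi>s \<subseteq> \<Psi>\<close> \<open>\<forall>v\<in>\<Psi>. 0 < Sigma_norm S v\<close> by blast
    then show "0 \<le> (MAX v\<in>\<Psi>s. pnorm q v)" "0 \<le> (MAX v\<in>\<Psi>s. Sigma_norm S v)"
      using max_q[OF v] max_S[OF v] pnorm_nonneg[of q v] by linarith+
  qed
  \<comment> \<open>This settles the case where the selected index is \<open>istar\<close> itself, for which there is no probe.\<close>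
  have B_ge: "?dist istar \<le> ?B"
    using max_nonneg \<kappa>(1) \<open>0 < \<epsilon>\<close> \<open>0 \<le> \<gamma>\<close> pnorm_nonneg[of p "m istar - \<mu>"]
    by (simp add: distrib_right)
  have good: "?dist (ihat \<omega>) \<le> ?B" if \<omega>: "\<omega> \<in> space M - ?bad" for \<omega>
  proof (cases "ihat \<omega> = istar")
    case True
    then show ?thesis
      using B_ge by simp
  next
    case False
    let ?v = "\<psi> istar (ihat \<omega>)"
    have v: "?v \<in> \<Psi>s"
      using False ihat(1) \<omega> by (auto simp: \<Psi>s_def)
    have noise: "\<bar>v \<bullet> w \<omega>\<bar> \<le> \<kappa> * Sigma_norm S v" if "v \<in> \<Psi>" for v
    proof -
      have "\<bar>v \<bullet> w \<omega>\<bar> / Sigma_norm S v \<le> (MAX v\<in>\<Psi>. \<bar>v \<bullet> w \<omega>\<bar> / Sigma_norm S v)"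
        using that fin by auto
      also have "\<dots> \<le> \<kappa>"
        using \<omega> by auto
      finally show ?thesis
        using \<open>\<forall>v\<in>\<Psi>. 0 < Sigma_norm S v\<close> that by (simp add: divide_le_eq)
    qed
    have "\<bar>?v \<bullet> (m istar - m (ihat \<omega>)) - pnorm p (m istar - m (ihat \<omega>))\<bar> \<le> \<gamma>"
      using \<open>good_probes \<gamma> p ?I m \<psi>\<close> False ihat(1) istar(1) \<omega> by (auto simp: good_probes_def)
    moreover have "selection_stat q S \<kappa> \<epsilon> \<Psi> (\<mu> + \<epsilon> *\<^sub>R w \<omega>) (m (ihat \<omega>))
        \<le> selection_stat q S \<kappa> \<epsilon> \<Psi> (\<mu> + \<epsilon> *\<^sub>R w \<omega>) (m istar)"
      using ihat(2)[of \<omega>] \<omega> unfolding \<open>Y = _\<close> by simp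
    ultimately have "?dist (ihat \<omega>)
        \<le> (2 * pnorm q ?v + 1) * ?dist istar + 2 * \<kappa> * \<epsilon> * Sigma_norm S ?v + \<gamma>"
      using selected_close_to_oracle[OF \<open>1 \<le> p\<close> \<open>inverse p + inverse q = 1\<close> less_imp_le[OF \<open>0 < \<epsilon>\<close>]
          fin ne nz noise subsetD[OF \<open>\<Psi>s \<subseteq> \<Psi>\<close> v]] by blast
    also have "\<dots> \<le> ?B"
      using max_q[OF v] max_S[OF v] \<kappa>(1) \<open>0 < \<epsilon>\<close>
      by (intro add_mono mult_right_mono mult_left_mono pnorm_nonneg) auto
    finally show ?thesis .
  qed
  have L: "pnorm p \<mu> \<le> L" "\<And>i. i \<in> ?I \<Longrightarrow> pnorm p (m i) \<le> L"
    unfolding \<open>L = _\<close> by (auto intro!: Max_ge simp del: Max_insert)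
  have always: "?dist (ihat \<omega>) \<le> 2 * L" if "\<omega> \<in> space M" for \<omega>
    using pnorm_triangle[OF \<open>1 \<le> p\<close>, of "m (ihat \<omega>)" "- \<mu>"] L(1) L(2)[OF ihat(1)[OF that]]
    by (simp add: pnorm_minus)
  have meas: "(\<lambda>\<omega>. ?dist (ihat \<omega>)) \<in> borel_measurable M"
    using \<open>ihat \<in> _\<close> by (rule measurable_compose) simp
  have [measurable]: "w \<in> borel_measurable M"
    using \<open>multivariate_normal M w 0 S\<close> by (simp add: multivariate_normal_def)
  have "(\<lambda>\<omega>. MAX v\<in>\<Psi>. \<bar>v \<bullet> w \<omega>\<bar> / Sigma_norm S v) \<in> borel_measurable M"
    using fin by (intro borel_measurable_Max) measurable
  then have bad: "?bad \<in> events"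
    by measurable
  have "0 \<le> ?B"
    using B_ge pnorm_nonneg[of p "m istar - \<mu>"] by linarith
  have "expectation (\<lambda>\<omega>. ?dist (ihat \<omega>)) \<le> ?B + 2 * L * \<delta>"
    using expectation_le_split[OF meas bad pnorm_nonneg always good \<open>0 \<le> ?B\<close> \<kappa>(2)] .
  then show ?thesis
    unfolding best .
qed

end
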